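(* Let $M$ be an Einstein (semi-Riemannian) manifold and let $\mathcal{T}_a\in\{R,\mathcal{C}_*,\mathcal{C},\mathcal{L},\mathcal{V},\mathcal{M},\mathcal{W}_0,\mathcal{W}_0^*,\mathcal{W}_3\}$. Then $M$ is $\mathcal{T}_a$-Ricci-semisymmetric.
   Context: Let $(M,g)$ be an $n$-dimensional semi-Riemannian manifold with curvature tensor $R$, Ricci tensor $S$ (with $S(Y,Z)$ the trace of $X\mapsto R(X,Y)Z$), Ricci operator $Q$ ($g(QX,Y)=S(X,Y)$) and scalar curvature $r$. For real numbers $a_0,\dots,a_7$, the $\mathcal{T}_a$-curvature tensor is $$\mathcal{T}_a(X,Y)Z=a_0R(X,Y)Z+a_1S(Y,Z)X+a_2S(X,Z)Y+a_3S(X,Y)Z+a_4g(Y,Z)QX+a_5g(X,Z)QY+a_6g(X,Y)QZ+a_7r\,(g(Y,Z)X-g(X,Z)Y).$$ Special cases (coefficients not mentioned are $0$): $R$: $a_0=1$; quasi-conformal $\mathcal{C}_*$: $a_0,a_1$ real, $a_1=-a_2=a_4=-a_5$, $a_7=-\frac1n\left(\frac{a_0}{n-1}+2a_1\right)$; conformal $\mathcal{C}$: $a_0=1$, $a_1=-a_2=a_4=-a_5=-\frac1{n-2}$, $a_7=\frac1{(n-1)(n-2)}$; conharmonic $\mathcal{L}$: $a_0=1$, $a_1=-a_2=a_4=-a_5=-\frac1{n-2}$; concircular $\mathcal{V}$: $a_0=1$, $a_7=-\frac1{n(n-1)}$; $\mathcal{M}$-projective $\mathcal{M}$: $a_0=1$,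 $a_1=-a_2=a_4=-a_5=-\frac1{2(n-1)}$; $\mathcal{W}_0$: $a_0=1$, $a_1=-a_5=-\frac1{n-1}$; $\mathcal{W}_0^*$: $a_0=1$, $a_1=-a_5=\frac1{n-1}$; $\mathcal{W}_3$: $a_0=1$, $a_2=-a_4=-\frac1{n-1}$. $M$ is Einstein if $S=\alpha g$ for a smooth function $\alpha$ on $M$. $M$ is $\mathcal{T}_a$-Ricci-semisymmetric if $\mathcal{T}_a(X,Y)\cdot S=0$ for all $X,Y$, i.e. $S(\mathcal{T}_a(X,Y)U,V)+S(U,\mathcal{T}_a(X,Y)V)=0$ for all $X,Y,U,V$. *)

theory Defs
  imports "HOL-Analysis.Analysis"
begin

section \<open>Smooth maps between normed spaces\<close>

text \<open>
  On an open subset of a finite-dimensional space, having continuous iterated directional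
  derivatives up to order \<open>k\<close> is the usual notion of being of class $C^k$.
\<close>

primrec Ck_on :: "nat \<Rightarrow> ('a::real_normed_vector \<Rightarrow> 'b::real_normed_vector) \<Rightarrow> 'a set \<Rightarrow> bool" where
  "Ck_on 0 f S \<longleftrightarrow> continuous_on S f"
| "Ck_on (Suc k) f S \<longleftrightarrow>
     (\<forall>x\<in>S. f differentiable (at x)) \<and>
     (\<forall>v. Ck_on k (\<lambda>x. frechet_derivative f (at x) v) S)"

definition smooth_on :: "'a::real_normed_vector set \<Rightarrow> ('a \<Rightarrow> 'b::real_normed_vector) \<Rightarrow> bool" where
  "smooth_on S f \<longleftrightarrow> (\<forall>k. Ck_on k f S)"


section \<open>Smooth manifolds\<close>

type_synonym ('m, 'n) chart = "'m set \<times> ('m \<Rightarrow> real ^ 'n)"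

definition chart_dom :: "('m, 'n::finite) chart \<Rightarrow> 'm set" where
  "chart_dom c = fst c"

definition chart_map :: "('m, 'n::finite) chart \<Rightarrow> 'm \<Rightarrow> real ^ 'n" where
  "chart_map c = snd c"

definition chart_img :: "('m, 'n::finite) chart \<Rightarrow> (real ^ 'n) set" where
  "chart_img c = chart_map c ` chart_dom c"

definition chart_inv :: "('m, 'n::finite) chart \<Rightarrow> real ^ 'n \<Rightarrow> 'm" where
  "chart_inv c = inv_into (chart_dom c) (chart_map c)"

definition transition :: "('m, 'n::finite) chart \<Rightarrow> ('m, 'n) chart \<Rightarrow> real ^ 'n \<Rightarrow> real ^ 'n" where
  "transition c d = chart_map d \<circ> chart_inv c"

text \<open>
  The atlas need not be maximal. The dimension of the manifold is the cardinality of \<open>'n\<close>.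
\<close>

locale smooth_manifold =
  fixes M :: "'m topology" and A :: "('m, 'n::finite) chart set"
  assumes Hausdorff: "Hausdorff_space M"
    and second_countable: "second_countable M"
    and covering: "topspace M = (\<Union>c\<in>A. chart_dom c)"
    and chart_dom_open: "\<And>c. c \<in> A \<Longrightarrow> openin M (chart_dom c)"
    and chart_img_open: "\<And>c. c \<in> A \<Longrightarrow> open (chart_img c)"
    and chart_homeomorphic: "\<And>c. c \<in> A \<Longrightarrow>
      homeomorphic_map (subtopology M (chart_dom c)) (top_of_set (chart_img c)) (chart_map c)"
    and transition_smooth: "\<And>c d. c \<in> A \<Longrightarrow> d \<in> A \<Longrightarrow>
      smooth_on (chart_map c ` (chart_dom c \<inter> chart_dom d)) (transition c d)"

definition smooth_function :: "('m, 'n::finite) chart set \<Rightarrow> ('m \<Rightarrow> real) \<Rightarrow> bool" where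
  "smooth_function A f \<longleftrightarrow> (\<forall>c\<in>A. smooth_on (chart_img c) (f \<circ> chart_inv c))"


section \<open>Tangent spaces\<close>

text \<open>
  A tangent vector at \<open>p\<close> is the family of its component vectors in all the charts around \<open>p\<close>,
  which are related by the differentials of the transition maps; the values at all other
  pairs are fixed to \<open>0\<close> so that equality of tangent vectors is equality of functions.
  The vector space operations are pointwise.
\<close>

type_synonym ('m, 'n) tangent = "('m, 'n) chart \<Rightarrow> real ^ 'n"

definition charts_at :: "('m, 'n::finite) chart set \<Rightarrow> 'm \<Rightarrow> ('m, 'n) chart set" where
  "charts_at A p = {c \<in> A. p \<in> chart_dom c}"

definition tangent_space :: "('m, 'n::finite) chart set \<Rightarrow> 'm \<Rightarrow> ('m, 'n) tangent set" where
  "tangent_space A p = {X.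
     (\<forall>c\<in>charts_at A p. \<forall>d\<in>charts_at A p.
        X d = frechet_derivative (transition c d) (at (chart_map c p)) (X c)) \<and>
     (\<forall>c. c \<notin> charts_at A p \<longrightarrow> X c = 0)}"

text \<open>The tangent vector at \<open>p\<close> whose component vector in the chart \<open>c\<close> is \<open>u\<close>.\<close>

definition tangent_of ::
  "('m, 'n::finite) chart set \<Rightarrow> ('m, 'n) chart \<Rightarrow> 'm \<Rightarrow> real ^ 'n \<Rightarrow> ('m, 'n) tangent" where
  "tangent_of A c p u = (\<lambda>d. if d \<in> charts_at A p
     then frechet_derivative (transition c d) (at (chart_map c p)) u else 0)"

text \<open>
  An arbitrary chart around \<open>p\<close>. It is used only to evaluate quantities that are
  invariant under change of charts (the trace of an endomorphism and the curvature tensor).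
\<close>

definition chart_at :: "('m, 'n::finite) chart set \<Rightarrow> 'm \<Rightarrow> ('m, 'n) chart" where
  "chart_at A p = (SOME c. c \<in> charts_at A p)"

definition tangent_trace ::
  "('m, 'n::finite) chart set \<Rightarrow> 'm \<Rightarrow> (('m, 'n) tangent \<Rightarrow> ('m, 'n) tangent) \<Rightarrow> real" where
  "tangent_trace A p L =
     (let c = chart_at A p in trace (matrix (\<lambda>u. L (tangent_of A c p u) c)))"


section \<open>Semi-Riemannian manifolds\<close>

type_synonym ('m, 'n) metric = "'m \<Rightarrow> ('m, 'n) tangent \<Rightarrow> ('m, 'n) tangent \<Rightarrow> real"

definition metric_in ::
  "('m, 'n::finite) chart set \<Rightarrow> ('m, 'n) metric \<Rightarrow> ('m, 'n) chart \<Rightarrow>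
   real ^ 'n \<Rightarrow> real ^ 'n \<Rightarrow> real ^ 'n \<Rightarrow> real" where
  "metric_in A g c x u v =
     (let p = chart_inv c x in g p (tangent_of A c p u) (tangent_of A c p v))"

definition form_index :: "(real ^ 'n \<Rightarrow> real ^ 'n \<Rightarrow> real) \<Rightarrow> nat" where
  "form_index b = Max {dim W |W. subspace W \<and> (\<forall>w\<in>W. w \<noteq> 0 \<longrightarrow> b w w < 0)}"

locale semi_riemannian_manifold = smooth_manifold M A
  for M :: "'m topology" and A :: "('m, 'n::finite) chart set" +
  fixes g :: "('m, 'n) metric"
  assumes metric_sym: "\<And>p X Y. p \<in> topspace M \<Longrightarrow> X \<in> tangent_space A p \<Longrightarrow>
      Y \<in> tangent_space A p \<Longrightarrow> g p X Y = g p Y X"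
    and metric_linear: "\<And>p X Y Z k. p \<in> topspace M \<Longrightarrow> X \<in> tangent_space A p \<Longrightarrow>
      Y \<in> tangent_space A p \<Longrightarrow> Z \<in> tangent_space A p \<Longrightarrow>
      g p (\<lambda>c. k *\<^sub>R X c + Y c) Z = k * g p X Z + g p Y Z"
    and metric_nondegenerate: "\<And>p X. p \<in> topspace M \<Longrightarrow> X \<in> tangent_space A p \<Longrightarrow>
      (\<forall>Y\<in>tangent_space A p. g p X Y = 0) \<Longrightarrow> X = (\<lambda>c. 0)"
    and metric_smooth: "\<And>c u v. c \<in> A \<Longrightarrow>
      smooth_on (chart_img c) (\<lambda>x. metric_in A g c x u v)"
    and metric_index_constant: "\<exists>k. \<forall>c\<in>A. \<forall>x\<in>chart_img c. form_index (metric_in A g c x) = k"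


section \<open>Levi-Civita connection and curvature\<close>

definition metric_matrix ::
  "('m, 'n::finite) chart set \<Rightarrow> ('m, 'n) metric \<Rightarrow> ('m, 'n) chart \<Rightarrow> real ^ 'n \<Rightarrow> real ^ 'n ^ 'n" where
  "metric_matrix A g c x = (\<chi> i j. metric_in A g c x (axis i 1) (axis j 1))"

definition partial :: "'n::finite \<Rightarrow> (real ^ 'n \<Rightarrow> real) \<Rightarrow> real ^ 'n \<Rightarrow> real" where
  "partial i f x = frechet_derivative f (at x) (axis i 1)"

text \<open>
  $\Gamma^k_{ij} = \frac12 \sum_l g^{kl}
     (\partial_i g_{jl} + \partial_j g_{il} - \partial_l g_{ij})$
\<close>

definition christoffel ::
  "('m, 'n::finite) chart set \<Rightarrow> ('m, 'n) metric \<Rightarrow> ('m, 'n) chart \<Rightarrow>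
   'n \<Rightarrow> 'n \<Rightarrow> 'n \<Rightarrow> real ^ 'n \<Rightarrow> real" where
  "christoffel A g c k i j x = (let G = metric_matrix A g c in
     1 / 2 * (\<Sum>l\<in>UNIV. matrix_inv (G x) $ k $ l *
       (partial i (\<lambda>y. G y $ j $ l) x + partial j (\<lambda>y. G y $ i $ l) x
          - partial l (\<lambda>y. G y $ i $ j) x)))"

text \<open>
  Within a chart \<open>c\<close>, a vector field is represented by a map \<open>real ^ 'n \<Rightarrow> real ^ 'n\<close>;
  \<open>cov_deriv A g c X Y\<close> is $\nabla_X Y$ for the Levi-Civita connection $\nabla$ of \<open>g\<close>.
\<close>

definition cov_deriv ::
  "('m, 'n::finite) chart set \<Rightarrow> ('m, 'n) metric \<Rightarrow> ('m, 'n) chart \<Rightarrow>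
   (real ^ 'n \<Rightarrow> real ^ 'n) \<Rightarrow> (real ^ 'n \<Rightarrow> real ^ 'n) \<Rightarrow> real ^ 'n \<Rightarrow> real ^ 'n" where
  "cov_deriv A g c X Y x = frechet_derivative Y (at x) (X x) +
     (\<chi> k. \<Sum>i\<in>UNIV. \<Sum>j\<in>UNIV. christoffel A g c k i j x * X x $ i * Y x $ j)"

definition lie_bracket ::
  "(real ^ 'n::finite \<Rightarrow> real ^ 'n) \<Rightarrow> (real ^ 'n \<Rightarrow> real ^ 'n) \<Rightarrow> real ^ 'n \<Rightarrow> real ^ 'n" where
  "lie_bracket X Y x = frechet_derivative Y (at x) (X x) - frechet_derivative X (at x) (Y x)"

definition field_curvature ::
  "('m, 'n::finite) chart set \<Rightarrow> ('m, 'n) metric \<Rightarrow> ('m, 'n) chart \<Rightarrow>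
   (real ^ 'n \<Rightarrow> real ^ 'n) \<Rightarrow> (real ^ 'n \<Rightarrow> real ^ 'n) \<Rightarrow> (real ^ 'n \<Rightarrow> real ^ 'n) \<Rightarrow>
   real ^ 'n \<Rightarrow> real ^ 'n" where
  "field_curvature A g c X Y Z x =
     cov_deriv A g c X (cov_deriv A g c Y Z) x - cov_deriv A g c Y (cov_deriv A g c X Z) x
     - cov_deriv A g c (lie_bracket X Y) Z x"

text \<open>
  Since the curvature is tensorial, its value on tangent vectors at \<open>p\<close> can be computed by
  extending them to vector fields with constant components in a chart around \<open>p\<close>.
\<close>

definition curvature ::
  "('m, 'n::finite) chart set \<Rightarrow> ('m, 'n) metric \<Rightarrow> 'm \<Rightarrow>
   ('m, 'n) tangent \<Rightarrow> ('m, 'n) tangent \<Rightarrow> ('m, 'n) tangent \<Rightarrow> ('m, 'n) tangent" where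
  "curvature A g p X Y Z = (let c = chart_at A p in tangent_of A c p
     (field_curvature A g c (\<lambda>_. X c) (\<lambda>_. Y c) (\<lambda>_. Z c) (chart_map c p)))"

definition ricci ::
  "('m, 'n::finite) chart set \<Rightarrow> ('m, 'n) metric \<Rightarrow> 'm \<Rightarrow>
   ('m, 'n) tangent \<Rightarrow> ('m, 'n) tangent \<Rightarrow> real" where
  "ricci A g p Y Z = tangent_trace A p (\<lambda>X. curvature A g p X Y Z)"

definition ricci_op ::
  "('m, 'n::finite) chart set \<Rightarrow> ('m, 'n) metric \<Rightarrow> 'm \<Rightarrow> ('m, 'n) tangent \<Rightarrow> ('m, 'n) tangent" where
  "ricci_op A g p X =
     (THE W. W \<in> tangent_space A p \<and> (\<forall>Y\<in>tangent_space A p. g p W Y = ricci A g p X Y))"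

definition scalar_curvature ::
  "('m, 'n::finite) chart set \<Rightarrow> ('m, 'n) metric \<Rightarrow> 'm \<Rightarrow> real" where
  "scalar_curvature A g p = tangent_trace A p (ricci_op A g p)"

definition einstein ::
  "'m topology \<Rightarrow> ('m, 'n::finite) chart set \<Rightarrow> ('m, 'n) metric \<Rightarrow> bool" where
  "einstein M A g \<longleftrightarrow> (\<exists>\<alpha>. smooth_function A \<alpha> \<and>
     (\<forall>p\<in>topspace M. \<forall>X\<in>tangent_space A p. \<forall>Y\<in>tangent_space A p.
        ricci A g p X Y = \<alpha> p * g p X Y))"


section \<open>The \<open>T\<^sub>a\<close>-curvature tensor\<close>

text \<open>The coefficients $a_0, \dots, a_7$ are the values \<open>a 0\<close>, \dots, \<open>a 7\<close>; other values are not used.\<close>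

definition Ta_curvature ::
  "('m, 'n::finite) chart set \<Rightarrow> ('m, 'n) metric \<Rightarrow> (nat \<Rightarrow> real) \<Rightarrow> 'm \<Rightarrow>
   ('m, 'n) tangent \<Rightarrow> ('m, 'n) tangent \<Rightarrow> ('m, 'n) tangent \<Rightarrow> ('m, 'n) tangent" where
  "Ta_curvature A g a p X Y Z = (let S = ricci A g p; Q = ricci_op A g p in (\<lambda>c.
     a 0 *\<^sub>R curvature A g p X Y Z c
     + (a 1 * S Y Z) *\<^sub>R X c + (a 2 * S X Z) *\<^sub>R Y c + (a 3 * S X Y) *\<^sub>R Z c
     + (a 4 * g p Y Z) *\<^sub>R Q X c + (a 5 * g p X Z) *\<^sub>R Q Y c + (a 6 * g p X Y) *\<^sub>R Q Z c
     + (a 7 * scalar_curvature A g p) *\<^sub>R (g p Y Z *\<^sub>R X c - g p X Z *\<^sub>R Y c)))"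

definition Ta_ricci_semisymmetric ::
  "'m topology \<Rightarrow> ('m, 'n::finite) chart set \<Rightarrow> ('m, 'n) metric \<Rightarrow> (nat \<Rightarrow> real) \<Rightarrow> bool" where
  "Ta_ricci_semisymmetric M A g a \<longleftrightarrow>
     (\<forall>p\<in>topspace M. \<forall>X\<in>tangent_space A p. \<forall>Y\<in>tangent_space A p.
      \<forall>U\<in>tangent_space A p. \<forall>V\<in>tangent_space A p.
        ricci A g p (Ta_curvature A g a p X Y U) V + ricci A g p U (Ta_curvature A g a p X Y V) = 0)"

text \<open>
  The coefficient families of the named curvature tensors in dimension \<open>n\<close>. Each one is
  present only in those dimensions in which the denominators in its definition do not vanish.
\<close>

definition riemann_coeffs :: "nat \<Rightarrow> real" where
  "riemann_coeffs = (\<lambda>_. 0)(0 := 1)"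

definition quasi_conformal_coeffs :: "real \<Rightarrow> real \<Rightarrow> real \<Rightarrow> nat \<Rightarrow> real" where
  "quasi_conformal_coeffs n b0 b1 =
     (\<lambda>_. 0)(0 := b0, 1 := b1, 2 := - b1, 4 := b1, 5 := - b1,
             7 := - (1 / n) * (b0 / (n - 1) + 2 * b1))"

definition conformal_coeffs :: "real \<Rightarrow> nat \<Rightarrow> real" where
  "conformal_coeffs n =
     (\<lambda>_. 0)(0 := 1, 1 := - (1 / (n - 2)), 2 := 1 / (n - 2), 4 := - (1 / (n - 2)), 5 := 1 / (n - 2),
             7 := 1 / ((n - 1) * (n - 2)))"

definition conharmonic_coeffs :: "real \<Rightarrow> nat \<Rightarrow> real" where
  "conharmonic_coeffs n =
     (\<lambda>_. 0)(0 := 1, 1 := - (1 / (n - 2)), 2 := 1 / (n - 2), 4 := - (1 / (n - 2)), 5 := 1 / (n - 2))"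

definition concircular_coeffs :: "real \<Rightarrow> nat \<Rightarrow> real" where
  "concircular_coeffs n = (\<lambda>_. 0)(0 := 1, 7 := - (1 / (n * (n - 1))))"

definition M_projective_coeffs :: "real \<Rightarrow> nat \<Rightarrow> real" where
  "M_projective_coeffs n =
     (\<lambda>_. 0)(0 := 1, 1 := - (1 / (2 * (n - 1))), 2 := 1 / (2 * (n - 1)),
             4 := - (1 / (2 * (n - 1))), 5 := 1 / (2 * (n - 1)))"

definition W0_coeffs :: "real \<Rightarrow> nat \<Rightarrow> real" where
  "W0_coeffs n = (\<lambda>_. 0)(0 := 1, 1 := - (1 / (n - 1)), 5 := 1 / (n - 1))"

definition W0_star_coeffs :: "real \<Rightarrow> nat \<Rightarrow> real" where
  "W0_star_coeffs n = (\<lambda>_. 0)(0 := 1, 1 := 1 / (n - 1), 5 := - (1 / (n - 1)))"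

definition W3_coeffs :: "real \<Rightarrow> nat \<Rightarrow> real" where
  "W3_coeffs n = (\<lambda>_. 0)(0 := 1, 2 := - (1 / (n - 1)), 4 := 1 / (n - 1))"

inductive_set special_Ta :: "nat \<Rightarrow> (nat \<Rightarrow> real) set" for n :: nat where
  riemann: "riemann_coeffs \<in> special_Ta n"
| quasi_conformal: "n \<ge> 2 \<Longrightarrow> quasi_conformal_coeffs (real n) b0 b1 \<in> special_Ta n"
| conformal: "n \<ge> 3 \<Longrightarrow> conformal_coeffs (real n) \<in> special_Ta n"
| conharmonic: "n \<ge> 3 \<Longrightarrow> conharmonic_coeffs (real n) \<in> special_Ta n"
| concircular: "n \<ge> 2 \<Longrightarrow> concircular_coeffs (real n) \<in> special_Ta n"
| M_projective: "n \<ge> 2 \<Longrightarrow> M_projective_coeffs (real n) \<in> special_Ta n"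
| W0: "n \<ge> 2 \<Longrightarrow> W0_coeffs (real n) \<in> special_Ta n"
| W0_star: "n \<ge> 2 \<Longrightarrow> W0_star_coeffs (real n) \<in> special_Ta n"
| W3: "n \<ge> 2 \<Longrightarrow> W3_coeffs (real n) \<in> special_Ta n"

end

theory Submission
  imports Defs
begin

text \<open>
  On an Einstein manifold $S = \alpha g$, so that $\mathcal T_a(X,Y) \cdot S = 0$ holds as soon as
  the endomorphism $\mathcal T_a(X,Y)$ is skew with respect to $g$. Moreover $Q = \alpha\,\mathrm{id}$,
  and the tensor collapses to
  $$\mathcal T_a(X,Y)Z = a_0 R(X,Y)Z + ((a_1+a_4)\alpha + a_7 r)\,g(Y,Z)X
    + ((a_2+a_5)\alpha - a_7 r)\,g(X,Z)Y + (a_3+a_6)\alpha\,g(X,Y)Z.$$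
  All the special coefficient families satisfy $a_3 + a_6 = 0$ and $a_1 + a_4 + a_2 + a_5 = 0$
  (\<open>special_Ta_coeffs\<close>), and then the terms after the first combine to a multiple of
  $g(Y,Z)X - g(X,Z)Y$, which is skew (\<open>einstein_Ta_skew\<close>).

  The substantial point is the skew-symmetry of $R(X,Y)$ itself (\<open>curvature_skew\<close>), because $R$ is
  given in a chart by the Christoffel symbols of the metric. The Koszul formula
  (\<open>metric_in_christoffel\<close>) gives the compatibility
  $\partial_w g(u,v) = g(\Gamma(w,u),v) + g(u,\Gamma(w,v))$ for constant fields $u$, $v$
  (\<open>metric_compatible\<close>). Differentiating this identity a second time and antisymmetrising, the left
  side vanishes as mixed second derivatives commute (\<open>mixed_derivatives_commute\<close>), and what remains
  on the right is $g(R(X,Y)u,v) + g(u,R(X,Y)v)$ (\<open>metric_connection_curvature_skew\<close>). The second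
  differentiation needs differentiable Christoffel symbols, hence a differentiable inverse
  of the metric matrix, which Cramer's rule provides (\<open>differentiable_matrix_inv\<close>).
\<close>

section \<open>Mixed directional derivatives\<close>

text \<open>
  The second difference of a function over a parallelogram is a value of a mixed second
  derivative, by the mean value theorem in each of the two directions. As the second difference
  does not depend on the order of the two directions, neither does the mixed derivative, provided
  it is continuous.
\<close>

lemma directional_mvt:
  fixes f :: "'a::real_normed_vector \<Rightarrow> real"
  assumes "t > 0" and "\<And>s. s \<in> {0..t} \<Longrightarrow> f differentiable at (x + s *\<^sub>R v)"
  obtains s where "s \<in> {0..t}" "f (x + t *\<^sub>R v) - f x = t * frechet_derivative f (at (x + s *\<^sub>R v)) v"
proof -
  have "((\<lambda>s. f (x + s *\<^sub>R v)) has_derivative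
      (\<lambda>r. r * frechet_derivative f (at (x + s *\<^sub>R v)) v)) (at s within {0..t})"
    if "s \<in> {0..t}" for s
  proof -
    have D: "(f has_derivative frechet_derivative f (at (x + s *\<^sub>R v))) (at (x + s *\<^sub>R v))"
      using assms(2)[OF that] frechet_derivative_works by blast
    have "((\<lambda>s. x + s *\<^sub>R v) has_derivative (\<lambda>r. r *\<^sub>R v)) (at s within {0..t})"
      by (auto intro!: derivative_eq_intros)
    from has_derivative_compose[OF this D] show ?thesis
      using linear_frechet_derivative[OF assms(2)[OF that]] by (simp add: linear_cmul)
  qed
  from mvt_very_simple[of 0 t "\<lambda>s. f (x + s *\<^sub>R v)", OF _ this] assms(1) that
  show ?thesis by auto
qed

lemma second_difference_mvt:
  fixes f :: "'a::real_normed_vector \<Rightarrow> real"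
  assumes t: "t > 0"
    and S: "\<And>r s. r \<in> {0..t} \<Longrightarrow> s \<in> {0..t} \<Longrightarrow> x + r *\<^sub>R v + s *\<^sub>R w \<in> S"
    and f: "\<And>y. y \<in> S \<Longrightarrow> f differentiable at y"
    and Df: "\<And>y. y \<in> S \<Longrightarrow> (\<lambda>z. frechet_derivative f (at z) v) differentiable at y"
  obtains r s where "r \<in> {0..t}" "s \<in> {0..t}"
    "f (x + t *\<^sub>R v + t *\<^sub>R w) - f (x + t *\<^sub>R v) - f (x + t *\<^sub>R w) + f x =
      t\<^sup>2 * frechet_derivative (\<lambda>z. frechet_derivative f (at z) v) (at (x + r *\<^sub>R v + s *\<^sub>R w)) w"
proof -
  \<comment> \<open>The second difference is the increment along \<open>t v\<close> of the increment \<open>?h\<close> along \<open>t w\<close>.\<close>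
  let ?h = "\<lambda>y. f (y + t *\<^sub>R w) - f y"
  have S0: "x + r *\<^sub>R v \<in> S" if "r \<in> {0..t}" for r
    using S[OF that, of 0] t by simp
  have St: "x + r *\<^sub>R v + t *\<^sub>R w \<in> S" if "r \<in> {0..t}" for r
    using S[OF that, of t] t by simp
  have h: "(?h has_derivative (\<lambda>u. frechet_derivative f (at (y + t *\<^sub>R w)) u
      - frechet_derivative f (at y) u)) (at y)" if "y \<in> S" "y + t *\<^sub>R w \<in> S" for y
  proof -
    have D1: "(f has_derivative frechet_derivative f (at (y + t *\<^sub>R w))) (at (y + t *\<^sub>R w))"
      and D2: "(f has_derivative frechet_derivative f (at y)) (at y)"
      using f that frechet_derivative_works by blast+
    have "((\<lambda>y. y + t *\<^sub>R w) has_derivative (\<lambda>u. u)) (at y)"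
      by (auto intro!: derivative_eq_intros)
    from has_derivative_compose[OF this D1] D2 show ?thesis
      by (rule has_derivative_diff)
  qed
  have "?h differentiable at (x + r *\<^sub>R v)" if "r \<in> {0..t}" for r
    using h[OF S0[OF that] St[OF that]] differentiableI by blast
  from directional_mvt[where f = ?h, OF t this]
  obtain r where r: "r \<in> {0..t}"
    "?h (x + t *\<^sub>R v) - ?h x = t * frechet_derivative ?h (at (x + r *\<^sub>R v)) v" by blast
  have fd: "frechet_derivative ?h (at (x + r *\<^sub>R v)) v =
      frechet_derivative f (at (x + r *\<^sub>R v + t *\<^sub>R w)) v - frechet_derivative f (at (x + r *\<^sub>R v)) v"
    using frechet_derivative_at[OF h[OF S0[OF r(1)] St[OF r(1)]]] by metis
  obtain s where s: "s \<in> {0..t}"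
    "frechet_derivative f (at (x + r *\<^sub>R v + t *\<^sub>R w)) v - frechet_derivative f (at (x + r *\<^sub>R v)) v =
     t * frechet_derivative (\<lambda>z. frechet_derivative f (at z) v) (at (x + r *\<^sub>R v + s *\<^sub>R w)) w"
    using directional_mvt[where f = "\<lambda>z. frechet_derivative f (at z) v" and x = "x + r *\<^sub>R v" and v = w,
        OF t Df[OF S[OF r(1)]]] by blast
  have "f (x + t *\<^sub>R v + t *\<^sub>R w) - f (x + t *\<^sub>R v) - f (x + t *\<^sub>R w) + f x = ?h (x + t *\<^sub>R v) - ?h x"
    by simp
  also have "\<dots> = t\<^sup>2 * frechet_derivative (\<lambda>z. frechet_derivative f (at z) v) (at (x + r *\<^sub>R v + s *\<^sub>R w)) w"
    unfolding r(2) fd s(2) by (simp add: power2_eq_square)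
  finally show ?thesis using that r(1) s(1) by blast
qed

lemma mixed_derivatives_commute:
  fixes f :: "'a::real_normed_vector \<Rightarrow> real"
  assumes S: "open S" "x \<in> S" and f: "Ck_on 2 f S"
  shows "frechet_derivative (\<lambda>y. frechet_derivative f (at y) v) (at x) w =
         frechet_derivative (\<lambda>y. frechet_derivative f (at y) w) (at x) v"
proof -
  let ?D = "\<lambda>v w y. frechet_derivative (\<lambda>z. frechet_derivative f (at z) v) (at y) w"
  have f1: "\<And>y. y \<in> S \<Longrightarrow> f differentiable at y"
    and f2: "\<And>y u. y \<in> S \<Longrightarrow> (\<lambda>z. frechet_derivative f (at z) u) differentiable at y"
    and f3: "\<And>u u'. continuous_on S (?D u u')"
    using f by (auto simp: numeral_2_eq_2)
  have "dist (?D v w x) (?D w v x) \<le> e" if "e > 0" for e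
  proof -
    have "\<exists>d>0. \<forall>y. dist y x < d \<longrightarrow> dist (?D u u' y) (?D u u' x) < e / 2" for u u'
    proof -
      have "isCont (?D u u') x"
        using f3[of u u'] S by (simp add: continuous_on_eq_continuous_at)
      then have "\<forall>\<epsilon>>0. \<exists>d>0. \<forall>y. dist y x < d \<longrightarrow> dist (?D u u' y) (?D u u' x) < \<epsilon>"
        unfolding continuous_at_eps_delta .
      then show ?thesis using \<open>e > 0\<close> half_gt_zero by metis
    qed
    then obtain d1 d2 where d: "d1 > 0" "d2 > 0"
      "\<And>y. dist y x < d1 \<Longrightarrow> dist (?D v w y) (?D v w x) < e / 2"
      "\<And>y. dist y x < d2 \<Longrightarrow> dist (?D w v y) (?D w v x) < e / 2"
      by metis
    obtain d3 where d3: "d3 > 0" "ball x d3 \<subseteq> S"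
      using S open_contains_ball by blast
    \<comment> \<open>The scale \<open>t\<close> keeps the whole parallelogram spanned by \<open>t v\<close> and \<open>t w\<close> inside \<open>ball x d\<close>.\<close>
    define d where "d = min d1 (min d2 d3)"
    define t where "t = d / (norm v + norm w + 1)"
    have "d > 0" using d d3 by (simp add: d_def)
    have t: "t > 0" using \<open>d > 0\<close> by (simp add: t_def add_nonneg_pos)
    have td: "t * (norm v + norm w) < d"
    proof -
      have "t * (norm v + norm w) < t * (norm v + norm w + 1)" using t by simp
      also have "\<dots> = d"
        using norm_ge_zero[of v] norm_ge_zero[of w] by (simp add: t_def add_nonneg_eq_0_iff)
      finally show ?thesis .
    qed
    have near: "dist (x + r *\<^sub>R v + s *\<^sub>R w) x < d" if "r \<in> {0..t}" "s \<in> {0..t}" for r s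
    proof -
      have "dist (x + r *\<^sub>R v + s *\<^sub>R w) x \<le> r * norm v + s * norm w"
        using norm_triangle_ineq[of "r *\<^sub>R v" "s *\<^sub>R w"] that
        by (simp add: dist_norm add.assoc)
      also have "\<dots> \<le> t * norm v + t * norm w"
        using that by (intro add_mono mult_right_mono) auto
      finally show ?thesis using td by (simp add: distrib_left)
    qed
    have inS: "x + r *\<^sub>R v + s *\<^sub>R w \<in> S" if "r \<in> {0..t}" "s \<in> {0..t}" for r s
      using near[OF that] d3 by (auto simp: d_def dist_commute)
    have inS': "x + s *\<^sub>R w + r *\<^sub>R v \<in> S" if "s \<in> {0..t}" "r \<in> {0..t}" for r s
      using inS[OF that(2,1)] by (simp add: add.commute add.left_commute)
    from second_difference_mvt[where f = f, OF t inS f1 f2]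
    obtain r s where rs: "r \<in> {0..t}" "s \<in> {0..t}"
      "f (x + t *\<^sub>R v + t *\<^sub>R w) - f (x + t *\<^sub>R v) - f (x + t *\<^sub>R w) + f x =
        t\<^sup>2 * ?D v w (x + r *\<^sub>R v + s *\<^sub>R w)" by blast
    from second_difference_mvt[where f = f, OF t inS' f1 f2]
    obtain r' s' where rs': "r' \<in> {0..t}" "s' \<in> {0..t}"
      "f (x + t *\<^sub>R w + t *\<^sub>R v) - f (x + t *\<^sub>R w) - f (x + t *\<^sub>R v) + f x =
        t\<^sup>2 * ?D w v (x + r' *\<^sub>R w + s' *\<^sub>R v)" by blast
    have "x + t *\<^sub>R w + t *\<^sub>R v = x + t *\<^sub>R v + t *\<^sub>R w" by simp
    then have "f (x + t *\<^sub>R w + t *\<^sub>R v) = f (x + t *\<^sub>R v + t *\<^sub>R w)" by (rule arg_cong)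
    with rs(3) rs'(3) have "t\<^sup>2 * ?D v w (x + r *\<^sub>R v + s *\<^sub>R w) = t\<^sup>2 * ?D w v (x + r' *\<^sub>R w + s' *\<^sub>R v)"
      by linarith
    then have eq: "?D v w (x + r *\<^sub>R v + s *\<^sub>R w) = ?D w v (x + r' *\<^sub>R w + s' *\<^sub>R v)"
      using t by simp
    have "dist (x + r' *\<^sub>R w + s' *\<^sub>R v) x < d"
      using near[OF rs'(2,1)] by (simp add: add.commute add.left_commute)
    then have "dist (?D w v (x + r' *\<^sub>R w + s' *\<^sub>R v)) (?D w v x) < e / 2"
      by (intro d) (simp add: d_def)
    moreover have "dist (?D v w (x + r *\<^sub>R v + s *\<^sub>R w)) (?D v w x) < e / 2"
      using near[OF rs(1,2)] by (intro d) (simp add: d_def)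
    ultimately show ?thesis unfolding eq dist_real_def by linarith
  qed
  then have "dist (?D v w x) (?D w v x) \<le> 0" by (rule field_le_epsilon) simp
  then show ?thesis by simp
qed

section \<open>Skew-symmetry of the curvature of a metric connection\<close>

text \<open>
  The product rule for \<open>y \<mapsto> B y (F y) v\<close>, where \<open>B\<close> is a field of bilinear forms and \<open>F\<close> a
  vector field.
\<close>

lemma has_derivative_form_field:
  fixes B :: "'a::euclidean_space \<Rightarrow> 'a \<Rightarrow> 'a \<Rightarrow> real"
  assumes S: "open S" "x \<in> S"
    and lin: "\<And>y. y \<in> S \<Longrightarrow> linear (\<lambda>u. B y u v)"
    and B: "\<And>u. ((\<lambda>y. B y u v) has_derivative (\<lambda>w. B' w u)) (at x)"
    and lin': "\<And>w. linear (B' w)"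
    and F: "(F has_derivative F') (at x)"
  shows "((\<lambda>y. B y (F y) v) has_derivative (\<lambda>w. B' w (F x) + B x (F' w) v)) (at x)"
proof -
  have expand: "h u = (\<Sum>b\<in>Basis. (u \<bullet> b) * h b)" if "linear h" for h :: "'a \<Rightarrow> real" and u
    using arg_cong[OF euclidean_representation[of u], of h, symmetric] that
    by (simp add: linear_sum linear_cmul)
  have "((\<lambda>y. \<Sum>b\<in>Basis. (F y \<bullet> b) * B y b v) has_derivative
        (\<lambda>w. \<Sum>b\<in>Basis. (F x \<bullet> b) * B' w b + (F' w \<bullet> b) * B x b v)) (at x)"
    by (intro has_derivative_sum has_derivative_mult B has_derivative_inner_left F)
  moreover have "(\<Sum>b\<in>Basis. (F x \<bullet> b) * B' w b + (F' w \<bullet> b) * B x b v) = B' w (F x) + B x (F' w) v" for w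
    using expand[OF lin', of w "F x"] expand[OF lin[OF S(2)], of "F' w"] by (simp add: sum.distrib)
  ultimately have "((\<lambda>y. \<Sum>b\<in>Basis. (F y \<bullet> b) * B y b v) has_derivative
        (\<lambda>w. B' w (F x) + B x (F' w) v)) (at x)"
    by simp
  then show ?thesis
    by (rule has_derivative_transform_within_open[OF _ S]) (rule expand[OF lin, symmetric])
qed

text \<open>
  Here \<open>\<Gamma> y w u\<close> is the covariant derivative at \<open>y\<close> of the constant field \<open>u\<close> in the direction
  \<open>w\<close>, and \<open>compat\<close> says that the connection \<open>\<Gamma>\<close> preserves the form \<open>B\<close>. Differentiating
  \<open>B y U V\<close> along \<open>Y\<close> and then along \<open>X\<close> and commuting the two derivatives gives the claim.
\<close>

lemma metric_connection_curvature_skew: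
  fixes B :: "'a::euclidean_space \<Rightarrow> 'a \<Rightarrow> 'a \<Rightarrow> real" and \<Gamma> :: "'a \<Rightarrow> 'a \<Rightarrow> 'a \<Rightarrow> 'a"
  assumes S: "open S" "x \<in> S"
    and bil: "\<And>y. y \<in> S \<Longrightarrow> bilinear (B y)"
    and sym: "\<And>y u v. y \<in> S \<Longrightarrow> B y u v = B y v u"
    and smooth: "\<And>u v. Ck_on 2 (\<lambda>y. B y u v) S"
    and \<Gamma>_lin: "\<And>y w. y \<in> S \<Longrightarrow> linear (\<Gamma> y w)"
    and compat: "\<And>y u v w. y \<in> S \<Longrightarrow>
      frechet_derivative (\<lambda>y. B y u v) (at y) w = B y (\<Gamma> y w u) v + B y u (\<Gamma> y w v)"
    and \<Gamma>_diff: "\<And>u v. (\<lambda>y. \<Gamma> y u v) differentiable at x"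
  defines "R \<equiv> \<lambda>X Y Z. frechet_derivative (\<lambda>y. \<Gamma> y Y Z) (at x) X + \<Gamma> x X (\<Gamma> x Y Z)
                  - (frechet_derivative (\<lambda>y. \<Gamma> y X Z) (at x) Y + \<Gamma> x Y (\<Gamma> x X Z))"
  shows "B x (R X Y U) V + B x U (R X Y V) = 0"
proof -
  have B_lin: "linear (\<lambda>u. B y u v)" if "y \<in> S" for y v
    using bil[OF that] by (simp add: bilinear_def)
  note B_simps = bilinear_ladd[OF bil[OF S(2)]] bilinear_radd[OF bil[OF S(2)]]
    bilinear_lsub[OF bil[OF S(2)]] bilinear_rsub[OF bil[OF S(2)]]
  have dB: "((\<lambda>y. B y u v) has_derivative (\<lambda>w. B x (\<Gamma> x w u) v + B x u (\<Gamma> x w v))) (at x)" for u v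
  proof -
    have "(\<lambda>y. B y u v) differentiable at x"
      using smooth S by (auto simp: numeral_2_eq_2)
    moreover have "frechet_derivative (\<lambda>y. B y u v) (at x) = (\<lambda>w. B x (\<Gamma> x w u) v + B x u (\<Gamma> x w v))"
      using compat[OF S(2)] by blast
    ultimately show ?thesis
      using frechet_derivative_works by metis
  qed
  have dF: "((\<lambda>y. B y (\<Gamma> y Y u) v) has_derivative
      (\<lambda>w. B x (\<Gamma> x w (\<Gamma> x Y u)) v + B x (\<Gamma> x Y u) (\<Gamma> x w v)
            + B x (frechet_derivative (\<lambda>y. \<Gamma> y Y u) (at x) w) v)) (at x)" for Y u v
  proof (rule has_derivative_form_field[where S = S and x = x])
    show "linear (\<lambda>u. B x (\<Gamma> x w u) v + B x u (\<Gamma> x w v))" for w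
      using linear_compose_add[OF linear_compose[OF \<Gamma>_lin[OF S(2)] B_lin[OF S(2)]] B_lin[OF S(2)]]
      by (simp add: o_def)
    show "((\<lambda>y. \<Gamma> y Y u) has_derivative frechet_derivative (\<lambda>y. \<Gamma> y Y u) (at x)) (at x)"
      using \<Gamma>_diff[of Y u] unfolding frechet_derivative_works .
  qed (fact S dB B_lin)+
  have second: "frechet_derivative (\<lambda>y. frechet_derivative (\<lambda>y. B y U V) (at y) Y) (at x) X =
      B x (\<Gamma> x X (\<Gamma> x Y U)) V + B x (\<Gamma> x Y U) (\<Gamma> x X V)
        + B x (frechet_derivative (\<lambda>y. \<Gamma> y Y U) (at x) X) V
      + (B x U (\<Gamma> x X (\<Gamma> x Y V)) + B x (\<Gamma> x X U) (\<Gamma> x Y V)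
        + B x U (frechet_derivative (\<lambda>y. \<Gamma> y Y V) (at x) X))" for X Y
  proof -
    have "((\<lambda>y. frechet_derivative (\<lambda>y. B y U V) (at y) Y) has_derivative
      (\<lambda>w. (B x (\<Gamma> x w (\<Gamma> x Y U)) V + B x (\<Gamma> x Y U) (\<Gamma> x w V)
            + B x (frechet_derivative (\<lambda>y. \<Gamma> y Y U) (at x) w) V)
         + (B x (\<Gamma> x w (\<Gamma> x Y V)) U + B x (\<Gamma> x Y V) (\<Gamma> x w U)
            + B x (frechet_derivative (\<lambda>y. \<Gamma> y Y V) (at x) w) U))) (at x)"
      by (rule has_derivative_transform_within_open[OF has_derivative_add[OF dF dF] S])
        (metis compat sym)
    note fun_cong[OF frechet_derivative_at[OF this, symmetric], of X]
    then show ?thesis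
      unfolding sym[OF S(2), of "\<Gamma> x X (\<Gamma> x Y V)" U] sym[OF S(2), of "\<Gamma> x Y V" "\<Gamma> x X U"]
        sym[OF S(2), of "frechet_derivative (\<lambda>y. \<Gamma> y Y V) (at x) X" U] .
  qed
  have "frechet_derivative (\<lambda>y. frechet_derivative (\<lambda>y. B y U V) (at y) Y) (at x) X =
        frechet_derivative (\<lambda>y. frechet_derivative (\<lambda>y. B y U V) (at y) X) (at x) Y"
    by (rule mixed_derivatives_commute[OF S smooth])
  \<comment> \<open>The terms \<open>B (\<Gamma> Y U) (\<Gamma> X V) + B (\<Gamma> X U) (\<Gamma> Y V)\<close> are symmetric in \<open>X\<close> and \<open>Y\<close> and cancel.\<close>
  then show ?thesis
    unfolding second R_def by (simp add: B_simps)
qed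


section \<open>Tangent vectors in charts\<close>

context smooth_manifold
begin

lemma topspace_chart:
  assumes "c \<in> A"
  shows "topspace (subtopology M (chart_dom c)) = chart_dom c"
  unfolding topspace_subtopology using openin_subset[OF chart_dom_open[OF assms]] by blast

lemma chart_inv_map:
  assumes "c \<in> A" "p \<in> chart_dom c"
  shows "chart_inv c (chart_map c p) = p"
proof -
  have "inj_on (chart_map c) (chart_dom c)"
    using homeomorphic_imp_injective_map[OF chart_homeomorphic[OF assms(1)]]
    unfolding topspace_chart[OF assms(1)] .
  then show ?thesis
    unfolding chart_inv_def using assms(2) by (rule inv_into_f_f)
qed

lemma chart_map_inv: "x \<in> chart_img c \<Longrightarrow> chart_map c (chart_inv c x) = x"
  by (simp add: chart_inv_def chart_img_def f_inv_into_f)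

lemma chart_inv_dom: "x \<in> chart_img c \<Longrightarrow> chart_inv c x \<in> chart_dom c"
  by (simp add: chart_inv_def chart_img_def inv_into_into)

lemma chart_map_img: "p \<in> chart_dom c \<Longrightarrow> chart_map c p \<in> chart_img c"
  by (simp add: chart_img_def)

lemma charts_at_inv: "c \<in> A \<Longrightarrow> x \<in> chart_img c \<Longrightarrow> c \<in> charts_at A (chart_inv c x)"
  by (simp add: charts_at_def chart_inv_dom)

lemma chart_at_mem: "p \<in> topspace M \<Longrightarrow> chart_at A p \<in> charts_at A p"
  unfolding chart_at_def by (rule someI_ex) (use covering in \<open>auto simp: charts_at_def\<close>)

lemma topspace_charts_at: "c \<in> charts_at A p \<Longrightarrow> p \<in> topspace M"
  using covering by (auto simp: charts_at_def)

lemma open_chart_image: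
  assumes c: "c \<in> A" and U: "openin M U" "U \<subseteq> chart_dom c"
  shows "open (chart_map c ` U)"
proof -
  have "openin (subtopology M (chart_dom c)) U"
    using U chart_dom_open[OF c] by (simp add: openin_open_subtopology)
  then have "openin (top_of_set (chart_img c)) (chart_map c ` U)"
    using homeomorphic_imp_open_map[OF chart_homeomorphic[OF c]] by (simp add: open_map_def)
  then show ?thesis
    using chart_img_open[OF c] by (simp add: openin_open_eq)
qed

lemma open_overlap:
  assumes "c \<in> A" "d \<in> A"
  shows "open (chart_map c ` (chart_dom c \<inter> chart_dom d))"
  by (rule open_chart_image[OF assms(1) openin_Int[OF chart_dom_open chart_dom_open]])
    (use assms in auto)

lemma charts_atD: "c \<in> charts_at A p \<Longrightarrow> c \<in> A" "c \<in> charts_at A p \<Longrightarrow> p \<in> chart_dom c"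
  by (simp_all add: charts_at_def)

lemma transition_differentiable:
  assumes "c \<in> charts_at A p" "d \<in> charts_at A p"
  shows "transition c d differentiable at (chart_map c p)"
proof -
  have "Ck_on (Suc 0) (transition c d) (chart_map c ` (chart_dom c \<inter> chart_dom d))"
    using transition_smooth[OF charts_atD(1)[OF assms(1)] charts_atD(1)[OF assms(2)]]
    unfolding smooth_on_def by (rule spec)
  moreover have "chart_map c p \<in> chart_map c ` (chart_dom c \<inter> chart_dom d)"
    using charts_atD(2)[OF assms(1)] charts_atD(2)[OF assms(2)] by simp
  ultimately show ?thesis unfolding Ck_on.simps by blast
qed

lemma transition_map: "c \<in> charts_at A p \<Longrightarrow> transition c d (chart_map c p) = chart_map d p"
  by (simp add: transition_def charts_atD chart_inv_map)

lemma transition_derivative_self: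
  assumes "c \<in> charts_at A p"
  shows "frechet_derivative (transition c c) (at (chart_map c p)) u = u"
proof -
  note c = charts_atD[OF assms]
  have "(transition c c has_derivative (\<lambda>u. u)) (at (chart_map c p))"
    by (rule has_derivative_transform_within_open[OF has_derivative_ident chart_img_open[OF c(1)]
          chart_map_img[OF c(2)]]) (simp add: transition_def chart_map_inv)
  from frechet_derivative_at[OF this] show ?thesis by metis
qed

lemma transition_derivative_chain:
  assumes "c \<in> charts_at A p" "d \<in> charts_at A p" "e \<in> charts_at A p"
  shows "frechet_derivative (transition c e) (at (chart_map c p)) u =
    frechet_derivative (transition d e) (at (chart_map d p))
      (frechet_derivative (transition c d) (at (chart_map c p)) u)"
proof -
  note c = charts_atD[OF assms(1)] and d = charts_atD[OF assms(2)]
  let ?x = "chart_map c p"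
  have D: "(transition c d has_derivative frechet_derivative (transition c d) (at ?x)) (at ?x)"
    using transition_differentiable[OF assms(1,2)] frechet_derivative_works by blast
  have "(transition d e has_derivative frechet_derivative (transition d e) (at (chart_map d p)))
      (at (transition c d ?x))"
    using transition_differentiable[OF assms(2,3)]
    unfolding transition_map[OF assms(1)] frechet_derivative_works .
  from has_derivative_compose[OF D this]
  have "((\<lambda>x. transition d e (transition c d x)) has_derivative
      (\<lambda>u. frechet_derivative (transition d e) (at (chart_map d p))
        (frechet_derivative (transition c d) (at ?x) u))) (at ?x)" .
  then have "(transition c e has_derivative
      (\<lambda>u. frechet_derivative (transition d e) (at (chart_map d p))
        (frechet_derivative (transition c d) (at ?x) u))) (at ?x)"
  proof (rule has_derivative_transform_within_open)
    show "open (chart_map c ` (chart_dom c \<inter> chart_dom d))"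
      using c d by (intro open_overlap)
    show "transition d e (transition c d x) = transition c e x"
      if "x \<in> chart_map c ` (chart_dom c \<inter> chart_dom d)" for x
      using that c d by (auto simp: transition_def chart_inv_map)
  qed (use c d in auto)
  from frechet_derivative_at[OF this] show ?thesis by metis
qed

text \<open>
  For a chart \<open>c\<close> around \<open>p\<close>, the map \<open>tangent_of A c p\<close> is a linear isomorphism onto the tangent
  space at \<open>p\<close>, with inverse \<open>X \<mapsto> X c\<close>. That it maps into the tangent space is the chain rule.
\<close>

lemma tangent_of_self: "c \<in> charts_at A p \<Longrightarrow> tangent_of A c p u c = u"
  by (simp add: tangent_of_def transition_derivative_self)

lemma tangent_of_in_tangent_space:
  assumes "c \<in> charts_at A p"
  shows "tangent_of A c p u \<in> tangent_space A p"
proof -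
  have eq: "tangent_of A c p u e = frechet_derivative (transition d e) (at (chart_map d p)) (tangent_of A c p u d)"
    if "d \<in> charts_at A p" "e \<in> charts_at A p" for d e
    using transition_derivative_chain[OF assms that] that by (simp only: tangent_of_def if_True)
  have zero: "tangent_of A c p u d = 0" if "d \<notin> charts_at A p" for d
    using that by (simp add: tangent_of_def)
  show ?thesis
    unfolding tangent_space_def by (intro CollectI conjI ballI allI impI eq zero)
qed

lemma tangent_of_component:
  assumes "c \<in> charts_at A p" "X \<in> tangent_space A p"
  shows "tangent_of A c p (X c) = X"
proof
  fix d
  show "tangent_of A c p (X c) d = X d"
  proof (cases "d \<in> charts_at A p")
    case True
    then have "X d = frechet_derivative (transition c d) (at (chart_map c p)) (X c)"
      using assms unfolding tangent_space_def by blast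
    then show ?thesis using True by (simp only: tangent_of_def if_True)
  next
    case False
    then have "X d = 0" using assms(2) unfolding tangent_space_def by blast
    then show ?thesis using False by (simp only: tangent_of_def if_False)
  qed
qed

lemma tangent_of_add_scale:
  assumes "c \<in> charts_at A p"
  shows "tangent_of A c p (k *\<^sub>R u + v) = (\<lambda>d. k *\<^sub>R tangent_of A c p u d + tangent_of A c p v d)"
proof
  fix d
  show "tangent_of A c p (k *\<^sub>R u + v) d = k *\<^sub>R tangent_of A c p u d + tangent_of A c p v d"
  proof (cases "d \<in> charts_at A p")
    case True
    then show ?thesis
      using linear_frechet_derivative[OF transition_differentiable[OF assms True]]
      by (simp add: tangent_of_def linear_add linear_cmul)
  qed (simp add: tangent_of_def)
qed

lemma tangent_space_linear:
  assumes "p \<in> topspace M" "X \<in> tangent_space A p" "Y \<in> tangent_space A p"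
  shows "(\<lambda>d. k *\<^sub>R X d + Y d) \<in> tangent_space A p"
proof -
  let ?c = "chart_at A p"
  have c: "?c \<in> charts_at A p" by (rule chart_at_mem[OF assms(1)])
  have eq: "tangent_of A ?c p (k *\<^sub>R X ?c + Y ?c) = (\<lambda>d. k *\<^sub>R X d + Y d)"
    unfolding tangent_of_add_scale[OF c] tangent_of_component[OF c assms(2)]
      tangent_of_component[OF c assms(3)] ..
  show ?thesis
    using tangent_of_in_tangent_space[OF c, of "k *\<^sub>R X ?c + Y ?c"] unfolding eq .
qed

lemma tangent_space_zero:
  assumes "p \<in> topspace M"
  shows "(\<lambda>d. 0) \<in> tangent_space A p"
proof -
  note mem = tangent_of_in_tangent_space[OF chart_at_mem[OF assms], of 0]
  from tangent_space_linear[OF assms mem mem, of "-1"] show ?thesis by simp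
qed

lemma tangent_space_scale:
  assumes "p \<in> topspace M" "X \<in> tangent_space A p"
  shows "(\<lambda>d. k *\<^sub>R X d) \<in> tangent_space A p"
  using tangent_space_linear[OF assms tangent_space_zero[OF assms(1)]] by simp

end


section \<open>The metric in a chart\<close>

context semi_riemannian_manifold
begin

lemma metric_scale:
  assumes "p \<in> topspace M" "X \<in> tangent_space A p" "Z \<in> tangent_space A p"
  shows "g p (\<lambda>c. k *\<^sub>R X c) Z = k * g p X Z"
proof -
  have "g p (\<lambda>c. 0) Z = 0"
    using metric_linear[OF assms(1,2,2,3), of "-1"] by simp
  then show ?thesis
    using metric_linear[OF assms(1,2) tangent_space_zero[OF assms(1)] assms(3)] by simp
qed

lemma metric_in_component:
  assumes "c \<in> charts_at A p" "X \<in> tangent_space A p" "Y \<in> tangent_space A p"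
  shows "metric_in A g c (chart_map c p) (X c) (Y c) = g p X Y"
  using tangent_of_component[OF assms(1,2)] tangent_of_component[OF assms(1,3)] charts_atD[OF assms(1)]
  by (simp add: metric_in_def chart_inv_map)

lemma metric_in_sym:
  assumes "c \<in> A" "x \<in> chart_img c"
  shows "metric_in A g c x u v = metric_in A g c x v u"
proof -
  note ca = charts_at_inv[OF assms]
  show ?thesis
    unfolding metric_in_def Let_def
    by (rule metric_sym[OF topspace_charts_at[OF ca] tangent_of_in_tangent_space[OF ca]
          tangent_of_in_tangent_space[OF ca]])
qed

lemma metric_in_bilinear:
  assumes "c \<in> A" "x \<in> chart_img c"
  shows "bilinear (metric_in A g c x)"
proof -
  note ca = charts_at_inv[OF assms]
  have lin: "metric_in A g c x (k *\<^sub>R u + u') v = k * metric_in A g c x u v + metric_in A g c x u' v"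
    for k u u' v
    unfolding metric_in_def Let_def tangent_of_add_scale[OF ca]
    by (rule metric_linear[OF topspace_charts_at[OF ca] tangent_of_in_tangent_space[OF ca]
          tangent_of_in_tangent_space[OF ca] tangent_of_in_tangent_space[OF ca]])
  have zero: "metric_in A g c x 0 v = 0" for v
    using lin[of 1 0 0 v] by simp
  have left: "linear (\<lambda>u. metric_in A g c x u v)" for v
  proof (rule linearI)
    show "metric_in A g c x (u + u') v = metric_in A g c x u v + metric_in A g c x u' v" for u u'
      using lin[of 1 u u' v] by simp
    show "metric_in A g c x (k *\<^sub>R u) v = k *\<^sub>R metric_in A g c x u v" for k u
      using lin[of k u 0 v] zero by simp
  qed
  moreover have "linear (\<lambda>v. metric_in A g c x u v)" for u
    unfolding metric_in_sym[OF assms, of u] by (rule left)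
  ultimately show ?thesis unfolding bilinear_def by blast
qed

lemma metric_in_nondegenerate:
  assumes "c \<in> A" "x \<in> chart_img c" "\<And>v. metric_in A g c x u v = 0"
  shows "u = 0"
proof -
  note ca = charts_at_inv[OF assms(1,2)]
  let ?p = "chart_inv c x"
  have "g ?p (tangent_of A c ?p u) Y = 0" if "Y \<in> tangent_space A ?p" for Y
    using assms(3)[of "Y c"] unfolding metric_in_def Let_def tangent_of_component[OF ca that] .
  then have "\<forall>Y\<in>tangent_space A ?p. g ?p (tangent_of A c ?p u) Y = 0" by (rule ballI)
  from metric_nondegenerate[OF topspace_charts_at[OF ca] tangent_of_in_tangent_space[OF ca] this]
  have "tangent_of A c ?p u c = 0" by (rule fun_cong)
  then show ?thesis unfolding tangent_of_self[OF ca] .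
qed

lemma metric_in_Ck: "c \<in> A \<Longrightarrow> Ck_on k (\<lambda>x. metric_in A g c x u v) (chart_img c)"
  using metric_smooth[of c u v] unfolding smooth_on_def by blast

lemma metric_in_differentiable:
  "c \<in> A \<Longrightarrow> x \<in> chart_img c \<Longrightarrow> (\<lambda>x. metric_in A g c x u v) differentiable at x"
  using metric_in_Ck[of c "Suc 0" u v] unfolding Ck_on.simps by blast

lemma metric_in_derivative_differentiable:
  "c \<in> A \<Longrightarrow> x \<in> chart_img c \<Longrightarrow>
    (\<lambda>y. frechet_derivative (\<lambda>x. metric_in A g c x u v) (at y) w) differentiable at x"
  using metric_in_Ck[of c "Suc (Suc 0)" u v] unfolding Ck_on.simps by blast

end


section \<open>Inverse matrices and multilinear forms\<close>

lemma matrix_inv_mult: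
  fixes A :: "'a::field^'n^'n"
  assumes "invertible A"
  shows "A ** matrix_inv A = mat 1"
  using someI_ex[OF assms[unfolded invertible_def]] unfolding matrix_inv_def by auto

lemma differentiable_prod_real:
  fixes f :: "'i \<Rightarrow> 'a::real_normed_vector \<Rightarrow> real"
  assumes "\<And>i. i \<in> I \<Longrightarrow> f i differentiable at x"
  shows "(\<lambda>y. \<Prod>i\<in>I. f i y) differentiable at x"
  using assms by (induction I rule: infinite_finite_induct) auto

lemma differentiable_det:
  fixes F :: "'a::real_normed_vector \<Rightarrow> real^'n^'n"
  assumes "\<And>i j. (\<lambda>y. F y $ i $ j) differentiable at x"
  shows "(\<lambda>y. det (F y)) differentiable at x"
  unfolding det_def
  by (intro differentiable_sum finite_permutations differentiable_mult differentiable_const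
      differentiable_prod_real assms ballI) simp

text \<open>Cramer's rule writes the entries of the inverse as quotients of determinants.\<close>

lemma matrix_inv_cramer:
  fixes A :: "real^'n^'n"
  assumes "invertible A"
  shows "matrix_inv A $ k $ l = det (\<chi> i j. if j = k then axis l 1 $ i else A $ i $ j) / det A"
proof -
  let ?v = "matrix_inv A *v axis l 1"
  have "A *v ?v = axis l 1"
    by (simp add: matrix_vector_mul_assoc matrix_inv_mult[OF assms])
  then have v: "?v = (\<chi> k. det (\<chi> i j. if j = k then axis l 1 $ i else A $ i $ j) / det A)"
    using cramer assms invertible_det_nz by blast
  have "matrix_inv A $ k $ l = ?v $ k"
    by (simp add: matrix_vector_mult_basis column_def)
  then show ?thesis unfolding v by simp
qed

lemma differentiable_matrix_inv:
  fixes F :: "'a::real_normed_vector \<Rightarrow> real^'n^'n"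
  assumes S: "open S" "x \<in> S" and inv: "\<And>y. y \<in> S \<Longrightarrow> invertible (F y)"
    and diff: "\<And>i j. (\<lambda>y. F y $ i $ j) differentiable at x"
  shows "(\<lambda>y. matrix_inv (F y) $ k $ l) differentiable at x"
proof -
  let ?q = "\<lambda>y. det (\<chi> i j. if j = k then axis l 1 $ i else F y $ i $ j) / det (F y)"
  have "(\<lambda>y. det (\<chi> i j. if j = k then axis l 1 $ i else F y $ i $ j)) differentiable at x"
  proof (rule differentiable_det)
    show "(\<lambda>y. (\<chi> i j. if j = k then axis l 1 $ i else F y $ i $ j) $ i $ j) differentiable at x" for i j
      using diff by (cases "j = k") simp_all
  qed
  then have "?q differentiable at x"
    using differentiable_det[OF diff] inv[OF S(2)]
    by (intro differentiable_divide) (simp_all add: invertible_det_nz)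
  then obtain q' where "(?q has_derivative q') (at x)" by (auto simp: differentiable_def)
  then have "((\<lambda>y. matrix_inv (F y) $ k $ l) has_derivative q') (at x)"
    by (rule has_derivative_transform_within_open[OF _ S]) (simp add: matrix_inv_cramer inv)
  then show ?thesis by (rule differentiableI)
qed

lemma trilinear_eq_axes:
  fixes f h :: "real^'n \<Rightarrow> real^'n \<Rightarrow> real^'n \<Rightarrow> real"
  assumes f: "\<And>u v. linear (\<lambda>w. f w u v)" "\<And>w v. linear (\<lambda>u. f w u v)" "\<And>w u. linear (f w u)"
    and h: "\<And>u v. linear (\<lambda>w. h w u v)" "\<And>w v. linear (\<lambda>u. h w u v)" "\<And>w u. linear (h w u)"
    and eq: "\<And>i j k. f (axis i 1) (axis j 1) (axis k 1) = h (axis i 1) (axis j 1) (axis k 1)"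
  shows "f w u v = h w u v"
proof -
  have ext: "p = q"
    if "linear p" "linear q" "\<And>i. p (axis i 1) = q (axis i 1)" for p q :: "real^'n \<Rightarrow> real"
    using linear_eq_stdbasis[OF that(1,2)] that(3) unfolding Basis_vec_def by auto
  have 1: "f (axis i 1) (axis j 1) v = h (axis i 1) (axis j 1) v" for i j v
    by (rule fun_cong, rule ext[OF f(3) h(3) eq])
  have 2: "f (axis i 1) u v = h (axis i 1) u v" for i u v
    by (rule fun_cong[where x = u], rule ext[OF f(2) h(2) 1])
  show ?thesis
    by (rule fun_cong[where x = w], rule ext[OF f(1) h(1) 2])
qed


section \<open>Christoffel symbols and curvature in a chart\<close>

text \<open>
  The covariant derivative, in the direction \<open>w\<close> and at the point with coordinates \<open>x\<close>, of the
  field with constant components \<open>u\<close> in the chart \<open>c\<close>.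
\<close>

definition christoffel_field ::
  "('m, 'n::finite) chart set \<Rightarrow> ('m, 'n) metric \<Rightarrow> ('m, 'n) chart \<Rightarrow>
   real ^ 'n \<Rightarrow> real ^ 'n \<Rightarrow> real ^ 'n \<Rightarrow> real ^ 'n" where
  "christoffel_field A g c x w u =
     (\<chi> k. \<Sum>i\<in>UNIV. \<Sum>j\<in>UNIV. christoffel A g c k i j x * w $ i * u $ j)"

lemma christoffel_field_linear_left: "linear (\<lambda>w. christoffel_field A g c x w u)"
  by (rule linearI)
    (simp_all add: christoffel_field_def vec_eq_iff algebra_simps sum.distrib sum_distrib_left)

lemma christoffel_field_linear_right: "linear (christoffel_field A g c x w)"
  by (rule linearI)
    (simp_all add: christoffel_field_def vec_eq_iff algebra_simps sum.distrib sum_distrib_left)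

lemma christoffel_field_axis:
  "christoffel_field A g c x (axis i 1) (axis j 1) $ k = christoffel A g c k i j x"
proof -
  have "christoffel A g c k i' j' x * axis i 1 $ i' * axis j 1 $ j' =
      (if j' = j then if i' = i then christoffel A g c k i j x else 0 else 0)" for i' j'
    by (simp add: axis_def)
  then show ?thesis by (simp add: christoffel_field_def)
qed

lemma cov_deriv_const:
  "cov_deriv A g c X (\<lambda>_. u) x = christoffel_field A g c x (X x) u"
  by (simp add: cov_deriv_def christoffel_field_def)

text \<open>The Lie bracket term of the curvature vanishes on fields with constant components.\<close>

lemma field_curvature_const:
  "field_curvature A g c (\<lambda>_. X) (\<lambda>_. Y) (\<lambda>_. Z) x =
     frechet_derivative (\<lambda>y. christoffel_field A g c y Y Z) (at x) X
       + christoffel_field A g c x X (christoffel_field A g c x Y Z)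
     - (frechet_derivative (\<lambda>y. christoffel_field A g c y X Z) (at x) Y
       + christoffel_field A g c x Y (christoffel_field A g c x X Z))"
proof -
  have outer: "cov_deriv A g c (\<lambda>_. V) F x =
      frechet_derivative F (at x) V + christoffel_field A g c x V (F x)" for V F
    by (simp add: cov_deriv_def christoffel_field_def)
  have inner: "cov_deriv A g c (\<lambda>_. V) (\<lambda>_. Z) = (\<lambda>y. christoffel_field A g c y V Z)" for V
    by (rule ext) (rule cov_deriv_const)
  have "cov_deriv A g c (lie_bracket (\<lambda>_. X) (\<lambda>_. Y)) (\<lambda>_. Z) x = 0"
    unfolding cov_deriv_const by (simp add: lie_bracket_def linear_0[OF christoffel_field_linear_left])
  then show ?thesis unfolding field_curvature_def inner outer by simp
qed

context semi_riemannian_manifold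
begin

lemma metric_matrix_mult:
  assumes "c \<in> A" "x \<in> chart_img c"
  shows "(metric_matrix A g c x *v u) $ i = metric_in A g c x (axis i 1) u"
proof -
  have lin: "linear (metric_in A g c x (axis i 1))"
    using metric_in_bilinear[OF assms] by (simp add: bilinear_def)
  have "metric_in A g c x (axis i 1) u = metric_in A g c x (axis i 1) (\<Sum>j\<in>UNIV. u $ j *\<^sub>R axis j 1)"
    using basis_expansion[of u] by (simp add: scalar_mult_eq_scaleR)
  also have "\<dots> = (\<Sum>j\<in>UNIV. u $ j * metric_in A g c x (axis i 1) (axis j 1))"
    by (simp add: linear_sum[OF lin] linear_cmul[OF lin])
  finally show ?thesis
    by (simp add: matrix_vector_mult_def metric_matrix_def mult.commute)
qed

lemma metric_matrix_invertible:
  assumes "c \<in> A" "x \<in> chart_img c"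
  shows "invertible (metric_matrix A g c x)"
proof -
  have "u = 0" if u: "metric_matrix A g c x *v u = 0" for u
  proof (rule metric_in_nondegenerate[OF assms])
    have lin: "linear (metric_in A g c x u)"
      using metric_in_bilinear[OF assms] by (simp add: bilinear_def)
    have "metric_in A g c x u (axis i 1) = 0" for i
      unfolding metric_in_sym[OF assms, of u "axis i 1"] metric_matrix_mult[OF assms, symmetric] u by simp
    then have "metric_in A g c x u = (\<lambda>_. 0)"
      by (intro linear_eq_stdbasis[OF lin linear_zero]) (auto simp: Basis_vec_def)
    then show "metric_in A g c x u v = 0" for v by (rule fun_cong)
  qed
  then show ?thesis
    unfolding invertible_left_inverse matrix_left_invertible_ker by blast
qed

text \<open>Lowering the upper index of the Christoffel symbols leaves those of the first kind.\<close>

lemma metric_in_christoffel_axis: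
  fixes i j m :: 'n
  assumes "c \<in> A" "x \<in> chart_img c"
  defines "D \<equiv> \<lambda>i j k. frechet_derivative (\<lambda>y. metric_in A g c y (axis j 1) (axis k 1)) (at x) (axis i 1)"
  shows "metric_in A g c x (christoffel_field A g c x (axis i 1) (axis j 1)) (axis m 1) =
    (D i j m + D j i m - D m i j) / 2"
proof -
  let ?G = "metric_matrix A g c x" and ?h = "\<chi> l. (D i j l + D j i l - D l i j) / 2"
  have part: "partial i (\<lambda>y. metric_matrix A g c y $ j $ l) x = D i j l" for i j l
    by (simp add: partial_def metric_matrix_def D_def)
  have "christoffel_field A g c x (axis i 1) (axis j 1) = matrix_inv ?G *v ?h"
    by (simp add: vec_eq_iff christoffel_field_axis christoffel_def part matrix_vector_mult_def
        sum_divide_distrib)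
  then have "?G *v christoffel_field A g c x (axis i 1) (axis j 1) = ?h"
    by (simp add: matrix_vector_mul_assoc matrix_inv_mult[OF metric_matrix_invertible[OF assms(1,2)]])
  then have "metric_in A g c x (axis m 1) (christoffel_field A g c x (axis i 1) (axis j 1)) = ?h $ m"
    unfolding metric_matrix_mult[OF assms(1,2), symmetric] by (rule arg_cong)
  then show ?thesis
    unfolding metric_in_sym[OF assms(1,2), of _ "axis m 1"] by simp
qed

lemma metric_in_derivative_sym:
  assumes "c \<in> A" "x \<in> chart_img c"
  shows "frechet_derivative (\<lambda>y. metric_in A g c y u v) (at x) =
    frechet_derivative (\<lambda>y. metric_in A g c y v u) (at x)"
  by (rule frechet_derivative_transform_within_open[OF metric_in_differentiable[OF assms]
        chart_img_open[OF assms(1)] assms(2) metric_in_sym[OF assms(1)]])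

lemma metric_in_derivative_linear:
  assumes "c \<in> A" "x \<in> chart_img c"
  shows "linear (\<lambda>w. frechet_derivative (\<lambda>y. metric_in A g c y u v) (at x) w)"
    and "linear (\<lambda>u. frechet_derivative (\<lambda>y. metric_in A g c y u v) (at x) w)"
    and "linear (\<lambda>v. frechet_derivative (\<lambda>y. metric_in A g c y u v) (at x) w)"
proof -
  let ?D = "\<lambda>u v. frechet_derivative (\<lambda>y. metric_in A g c y u v) (at x)"
  note op = chart_img_open[OF assms(1)] assms(2)
  have der: "((\<lambda>y. metric_in A g c y u v) has_derivative ?D u v) (at x)" for u v
    using metric_in_differentiable[OF assms] unfolding frechet_derivative_works .
  show "linear (\<lambda>w. ?D u v w)"
    using linear_frechet_derivative[OF metric_in_differentiable[OF assms]] by simp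
  have left: "linear (\<lambda>u. ?D u v w)" for v w
  proof (rule linearI)
    fix u u' :: "real ^ 'n" and k :: real
    have "((\<lambda>y. metric_in A g c y (u + u') v) has_derivative (\<lambda>w. ?D u v w + ?D u' v w)) (at x)"
      by (rule has_derivative_transform_within_open[OF has_derivative_add[OF der der] op])
        (simp add: bilinear_ladd[OF metric_in_bilinear[OF assms(1)]])
    from fun_cong[OF frechet_derivative_at[OF this]]
    show "?D (u + u') v w = ?D u v w + ?D u' v w" by simp
    have "((\<lambda>y. metric_in A g c y (k *\<^sub>R u) v) has_derivative (\<lambda>w. k *\<^sub>R ?D u v w)) (at x)"
      by (rule has_derivative_transform_within_open[OF has_derivative_scaleR_right[OF der] op])
        (simp add: bilinear_lmul[OF metric_in_bilinear[OF assms(1)]])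
    from fun_cong[OF frechet_derivative_at[OF this]]
    show "?D (k *\<^sub>R u) v w = k *\<^sub>R ?D u v w" by simp
  qed
  then show "linear (\<lambda>u. ?D u v w)" .
  have "(\<lambda>v. ?D u v w) = (\<lambda>v. ?D v u w)"
    by (rule ext) (rule fun_cong[OF metric_in_derivative_sym[OF assms]])
  then show "linear (\<lambda>v. ?D u v w)" using left[of u w] by simp
qed

text \<open>The Koszul formula for fields with constant components.\<close>

lemma metric_in_christoffel:
  assumes "c \<in> A" "x \<in> chart_img c"
  defines "D \<equiv> \<lambda>w u v. frechet_derivative (\<lambda>y. metric_in A g c y u v) (at x) w"
  shows "metric_in A g c x (christoffel_field A g c x w u) v = (D w u v + D u w v - D v w u) / 2"
proof -
  note bil = metric_in_bilinear[OF assms(1,2)]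
  have B1: "linear (\<lambda>u. metric_in A g c x u v)" for v
    using bil by (simp add: bilinear_def)
  have B2: "linear (metric_in A g c x u)" for u
    using bil by (simp add: bilinear_def)
  have D1: "linear (\<lambda>w. D w u v)" and D2: "linear (\<lambda>u. D w u v)" and D3: "linear (D w u)" for w u v
    unfolding D_def using metric_in_derivative_linear[OF assms(1,2)] by blast+
  have half: "linear (\<lambda>u. (p u + q u - r u) / 2)" if "linear p" "linear q" "linear r"
    for p q r :: "real ^ 'n \<Rightarrow> real"
    using that by (simp add: linear_iff algebra_simps add_divide_distrib diff_divide_distrib)
  show ?thesis
  proof (rule trilinear_eq_axes[where h = "\<lambda>w u v. (D w u v + D u w v - D v w u) / 2"
        and f = "\<lambda>w u v. metric_in A g c x (christoffel_field A g c x w u) v"])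
    show "linear (\<lambda>w. metric_in A g c x (christoffel_field A g c x w u) v)" for u v
      using linear_compose[OF christoffel_field_linear_left B1] by (simp add: o_def)
    show "linear (\<lambda>u. metric_in A g c x (christoffel_field A g c x w u) v)" for w v
      using linear_compose[OF christoffel_field_linear_right B1] by (simp add: o_def)
    show "linear (metric_in A g c x (christoffel_field A g c x w u))" for w u
      by (rule B2)
    show "linear (\<lambda>w. (D w u v + D u w v - D v w u) / 2)" for u v
      by (rule half[OF D1 D2 D2])
    show "linear (\<lambda>u. (D w u v + D u w v - D v w u) / 2)" for w v
      by (rule half[OF D2 D1 D3])
    show "linear (\<lambda>v. (D w u v + D u w v - D v w u) / 2)" for w u
      by (rule half[OF D3 D3 D1])
    show "metric_in A g c x (christoffel_field A g c x (axis i 1) (axis j 1)) (axis k 1) =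
        (D (axis i 1) (axis j 1) (axis k 1) + D (axis j 1) (axis i 1) (axis k 1)
          - D (axis k 1) (axis i 1) (axis j 1)) / 2" for i j k
      unfolding D_def by (rule metric_in_christoffel_axis[OF assms(1,2)])
  qed
qed

text \<open>
  In the sum of the two Koszul formulas only the derivatives along \<open>w\<close> survive, so the connection
  given by the Christoffel symbols preserves the metric.
\<close>

lemma metric_compatible:
  assumes "c \<in> A" "x \<in> chart_img c"
  shows "frechet_derivative (\<lambda>y. metric_in A g c y u v) (at x) w =
    metric_in A g c x (christoffel_field A g c x w u) v + metric_in A g c x u (christoffel_field A g c x w v)"
proof -
  note metric_in_derivative_sym[OF assms, of v u] metric_in_derivative_sym[OF assms, of w v]
    metric_in_derivative_sym[OF assms, of w u]
  then show ?thesis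
    unfolding metric_in_sym[OF assms, of u] metric_in_christoffel[OF assms] by (simp add: field_simps)
qed

lemma christoffel_field_differentiable:
  assumes "c \<in> A" "x \<in> chart_img c"
  shows "(\<lambda>y. christoffel_field A g c y w u) differentiable at x"
proof -
  have G: "(\<lambda>y. metric_matrix A g c y $ i $ j) differentiable at x" for i j
    unfolding metric_matrix_def using metric_in_differentiable[OF assms] by simp
  have G': "(\<lambda>y. partial k (\<lambda>z. metric_matrix A g c z $ i $ j) y) differentiable at x" for i j k
    unfolding metric_matrix_def partial_def using metric_in_derivative_differentiable[OF assms] by simp
  have Ginv: "(\<lambda>y. matrix_inv (metric_matrix A g c y) $ k $ l) differentiable at x" for k l
    by (rule differentiable_matrix_inv[OF chart_img_open[OF assms(1)] assms(2)
          metric_matrix_invertible[OF assms(1)] G])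
  have "(\<lambda>y. christoffel A g c k i j y) differentiable at x" for k i j
    unfolding christoffel_def Let_def
    by (intro differentiable_mult differentiable_const differentiable_sum differentiable_add
        differentiable_diff finite ballI Ginv G')
  then have "(\<lambda>y. christoffel_field A g c y w u $ k) differentiable at x" for k
    unfolding christoffel_field_def vec_lambda_beta
    by (intro differentiable_sum differentiable_mult differentiable_const finite ballI)
  then show ?thesis
    by (subst differentiable_componentwise_within) (auto simp: Basis_vec_def inner_axis)
qed

lemma curvature_skew:
  assumes p: "p \<in> topspace M" and U: "U \<in> tangent_space A p" and V: "V \<in> tangent_space A p"
  shows "g p (curvature A g p X Y U) V + g p U (curvature A g p X Y V) = 0"
proof -
  define c where "c = chart_at A p"
  have ca: "c \<in> charts_at A p" unfolding c_def by (rule chart_at_mem[OF p])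
  note cA = charts_atD(1)[OF ca]
  define x where "x = chart_map c p"
  have x: "x \<in> chart_img c" unfolding x_def by (rule chart_map_img[OF charts_atD(2)[OF ca]])
  let ?K = "\<lambda>W. field_curvature A g c (\<lambda>_. X c) (\<lambda>_. Y c) (\<lambda>_. W c) x"
  have K: "curvature A g p X Y W = tangent_of A c p (?K W)" for W
    by (simp add: curvature_def Let_def c_def x_def)
  have Kc: "curvature A g p X Y W \<in> tangent_space A p" "curvature A g p X Y W c = ?K W" for W
    unfolding K by (rule tangent_of_in_tangent_space[OF ca], rule tangent_of_self[OF ca])
  have "metric_in A g c x (?K U) (V c) + metric_in A g c x (U c) (?K V) = 0"
    unfolding field_curvature_const
  proof (rule metric_connection_curvature_skew[OF chart_img_open[OF cA] x])
    show "bilinear (metric_in A g c y)" if "y \<in> chart_img c" for y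
      by (rule metric_in_bilinear[OF cA that])
    show "metric_in A g c y u v = metric_in A g c y v u" if "y \<in> chart_img c" for y u v
      by (rule metric_in_sym[OF cA that])
    show "Ck_on 2 (\<lambda>y. metric_in A g c y u v) (chart_img c)" for u v
      by (rule metric_in_Ck[OF cA])
    show "linear (christoffel_field A g c y w)" for y w
      by (rule christoffel_field_linear_right)
    show "frechet_derivative (\<lambda>y. metric_in A g c y u v) (at y) w =
        metric_in A g c y (christoffel_field A g c y w u) v
          + metric_in A g c y u (christoffel_field A g c y w v)"
      if "y \<in> chart_img c" for y u v w
      by (rule metric_compatible[OF cA that])
    show "(\<lambda>y. christoffel_field A g c y u v) differentiable at x" for u v
      by (rule christoffel_field_differentiable[OF cA x])
  qed
  then have "metric_in A g c x (curvature A g p X Y U c) (V c)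
      + metric_in A g c x (U c) (curvature A g p X Y V c) = 0"
    unfolding Kc(2) .
  then show ?thesis
    unfolding x_def metric_in_component[OF ca Kc(1) V] metric_in_component[OF ca U Kc(1)] .
qed

lemma curvature_in_tangent_space:
  assumes "p \<in> topspace M"
  shows "curvature A g p X Y Z \<in> tangent_space A p"
  unfolding curvature_def Let_def by (rule tangent_of_in_tangent_space[OF chart_at_mem[OF assms]])

end


section \<open>Einstein manifolds\<close>

context semi_riemannian_manifold
begin

lemma einstein_ricci_op:
  assumes p: "p \<in> topspace M"
    and S: "\<And>X Y. X \<in> tangent_space A p \<Longrightarrow> Y \<in> tangent_space A p \<Longrightarrow> ricci A g p X Y = k * g p X Y"
    and X: "X \<in> tangent_space A p"
  shows "ricci_op A g p X = (\<lambda>c. k *\<^sub>R X c)"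
  unfolding ricci_op_def
proof (rule the_equality)
  show "(\<lambda>c. k *\<^sub>R X c) \<in> tangent_space A p \<and>
      (\<forall>Y\<in>tangent_space A p. g p (\<lambda>c. k *\<^sub>R X c) Y = ricci A g p X Y)"
    using tangent_space_scale[OF p X] metric_scale[OF p X] S[OF X] by simp
next
  fix W assume "W \<in> tangent_space A p \<and> (\<forall>Y\<in>tangent_space A p. g p W Y = ricci A g p X Y)"
  then have W: "W \<in> tangent_space A p"
    and gW: "\<And>Y. Y \<in> tangent_space A p \<Longrightarrow> g p W Y = k * g p X Y"
    using S[OF X] by auto
  \<comment> \<open>The difference of \<open>W\<close> and \<open>k X\<close> is orthogonal to the whole tangent space.\<close>
  let ?N = "\<lambda>c. (- k) *\<^sub>R X c + W c"
  have N: "?N \<in> tangent_space A p" by (rule tangent_space_linear[OF p X W])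
  have "g p ?N Y = 0" if "Y \<in> tangent_space A p" for Y
    using metric_linear[OF p X W that, of "- k"] gW[OF that] by simp
  then have "?N = (\<lambda>c. 0)" using metric_nondegenerate[OF p N] by blast
  then have "?N c = 0" for c by (rule fun_cong)
  then show "W = (\<lambda>c. k *\<^sub>R X c)" by (simp add: fun_eq_iff)
qed

text \<open>
  Under the two conditions on the coefficients, and with the Ricci tensor equal to \<open>k * g\<close> at \<open>p\<close>,
  the tensor is \<open>a 0\<close> times the curvature plus \<open>q\<close> times \<open>g(Y,Z) X - g(X,Z) Y\<close>, and both parts
  are skew with respect to the metric. Below, \<open>T\<close> is the second part.
\<close>

lemma einstein_Ta_skew:
  assumes p: "p \<in> topspace M"
    and S: "\<And>X Y. X \<in> tangent_space A p \<Longrightarrow> Y \<in> tangent_space A p \<Longrightarrow> ricci A g p X Y = k * g p X Y"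
    and a36: "a 3 + a 6 = 0" and a1245: "a 1 + a 4 + (a 2 + a 5) = 0"
    and X: "X \<in> tangent_space A p" and Y: "Y \<in> tangent_space A p"
    and U: "U \<in> tangent_space A p" and V: "V \<in> tangent_space A p"
  shows "ricci A g p (Ta_curvature A g a p X Y U) V + ricci A g p U (Ta_curvature A g a p X Y V) = 0"
proof -
  let ?R = "curvature A g p X Y"
  define q where "q = (a 1 + a 4) * k + a 7 * scalar_curvature A g p"
  define T where "T Z = (\<lambda>c. (q * g p Y Z) *\<^sub>R X c + (\<lambda>c. (- q * g p X Z) *\<^sub>R Y c) c)" for Z
  note R = curvature_in_tangent_space[OF p, of X Y]
  have T: "T Z \<in> tangent_space A p" for Z
    unfolding T_def by (rule tangent_space_linear[OF p X tangent_space_scale[OF p Y]])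
  have gT: "g p (T Z) W = q * (g p Y Z * g p X W - g p X Z * g p Y W)"
    if "W \<in> tangent_space A p" for Z W
    unfolding T_def metric_linear[OF p X tangent_space_scale[OF p Y] that] metric_scale[OF p Y that]
    by (simp add: algebra_simps)
  have Q: "ricci_op A g p W = (\<lambda>c. k *\<^sub>R W c)" if "W \<in> tangent_space A p" for W
    by (rule einstein_ricci_op[OF p _ that]) (rule S)
  have Ta: "Ta_curvature A g a p X Y Z = (\<lambda>c. a 0 *\<^sub>R ?R Z c + T Z c)"
    if Z: "Z \<in> tangent_space A p" for Z
  proof
    fix c
    have a6: "a 6 = - a 3" and a5: "a 5 = - (a 1 + a 4) - a 2" using a36 a1245 by linarith+
    show "Ta_curvature A g a p X Y Z c = a 0 *\<^sub>R ?R Z c + T Z c"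
      unfolding Ta_curvature_def Let_def S[OF Y Z] S[OF X Z] S[OF X Y]
        Q[OF X] Q[OF Y] Q[OF Z]
        T_def q_def a6 a5
      by (simp add: algebra_simps)
  qed
  have Ta_mem: "Ta_curvature A g a p X Y Z \<in> tangent_space A p" if "Z \<in> tangent_space A p" for Z
    unfolding Ta[OF that] by (rule tangent_space_linear[OF p R T])
  have gTa: "g p (Ta_curvature A g a p X Y Z) W =
      a 0 * g p (?R Z) W + q * (g p Y Z * g p X W - g p X Z * g p Y W)"
    if "Z \<in> tangent_space A p" "W \<in> tangent_space A p" for Z W
    unfolding Ta[OF that(1)] metric_linear[OF p R T that(2)] gT[OF that(2)] ..
  have "g p (?R U) V + g p (?R V) U = 0"
    using curvature_skew[OF p U V, of X Y] unfolding metric_sym[OF p U R] .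
  then have "a 0 * (g p (?R U) V + g p (?R V) U) = 0" by simp
  then have "g p (Ta_curvature A g a p X Y U) V + g p (Ta_curvature A g a p X Y V) U = 0"
    unfolding gTa[OF U V] gTa[OF V U] by (simp add: algebra_simps)
  then have "k * (g p (Ta_curvature A g a p X Y U) V + g p U (Ta_curvature A g a p X Y V)) = 0"
    unfolding metric_sym[OF p U Ta_mem[OF V]] by simp
  then show ?thesis
    unfolding S[OF Ta_mem[OF U] V] S[OF U Ta_mem[OF V]] by (simp add: distrib_left)
qed

end

lemma special_Ta_coeffs:
  assumes "a \<in> special_Ta n"
  shows "a 3 + a 6 = 0" and "a 1 + a 4 + (a 2 + a 5) = 0"
  using assms
  by (cases; simp add: riemann_coeffs_def quasi_conformal_coeffs_def conformal_coeffs_def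
      conharmonic_coeffs_def concircular_coeffs_def M_projective_coeffs_def
      W0_coeffs_def W0_star_coeffs_def W3_coeffs_def)+

theorem theorem7p5:
  fixes M :: "'m topology" and A :: "('m, 'n::finite) chart set" and g :: "('m, 'n) metric"
    and a :: "nat \<Rightarrow> real"
  assumes "semi_riemannian_manifold M A g"
    and "einstein M A g"
    and "a \<in> special_Ta CARD('n)"
  shows "Ta_ricci_semisymmetric M A g a"
proof -
  interpret semi_riemannian_manifold M A g by (rule assms(1))
  obtain \<alpha> where \<alpha>: "\<And>p X Y. p \<in> topspace M \<Longrightarrow> X \<in> tangent_space A p \<Longrightarrow> Y \<in> tangent_space A p \<Longrightarrow>
      ricci A g p X Y = \<alpha> p * g p X Y"
    using assms(2) unfolding einstein_def by blast
  show ?thesis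
    unfolding Ta_ricci_semisymmetric_def
    by (intro ballI einstein_Ta_skew[OF _ \<alpha>] special_Ta_coeffs[OF assms(3)])
qed

end
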